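(* Let $p$ be a natural number whose last decimal digit is $1$, such that $p\equiv 2 \pmod 3$ or $p\equiv 1\pmod 3$, and such that $p+10$ is a multiple of $9$. Suppose $(A,B)\in\mathbb{N}\times\mathbb{N}$, with $A<B$, satisfies $p=(10A+9)(10B+9)$. Then there exist $\lambda, C, D\in\mathbb{N}\cup\{0\}$ such that $$A=\frac{D+1-10\lambda-\sqrt{(10\lambda-1-D)^{2}-4(9\lambda-1)}}{2}$$ and $$B=\frac{D+1-10\lambda+\sqrt{(10\lambda-1-D)^{2}-4(9\lambda-1)}}{2},$$ and such that, whenever $A\geq 10$ and $B\geq 10$, $$D+1-\frac{101^{2}\,p}{10^{6}}\leq \lambda \leq \frac{D+1}{10}+\frac{9-\sqrt{p}}{50}.$$
   Context: $\mathbb{N}$ denotes the set of positive integers $\{1,2,3,\dots\}$. The inequalities and formulas are between real numbers. The integer $C$ is asserted to exist but does not occur in the displayed formulas. *)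

theory Defs
  imports Complex_Main
begin

end

theory Submission
  imports Defs
begin

text \<open>
  The two displayed formulas say that \<open>A < B\<close> are the roots of a monic quadratic with sum
  \<open>D + 1 - 10 \<lambda>\<close> and product \<open>9 \<lambda> - 1\<close>. Expanding
  \<open>p = (10 A + 9) (10 B + 9)\<close> modulo \<open>9\<close> gives \<open>p + 10 \<equiv> A B + 1\<close>, so
  \<open>\<lambda> = (A B + 1) / 9\<close> is an integer, and the sum then determines
  \<open>D = A + B - 1 + 10 \<lambda>\<close>.

  With this choice the two estimates become statements about \<open>A\<close> and \<open>B\<close> alone.
  Since \<open>D + 1 - \<lambda> = (A + 1) (B + 1)\<close>, the lower bound for \<open>\<lambda>\<close> is the product of two
  copies of the linear estimate \<open>x + 1 \<le> (101/1000) (10 x + 9)\<close>, which holds for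
  \<open>x \<ge> 9.1\<close>. Since \<open>D + 1 - 10 \<lambda> = A + B\<close>, the upper bound is the inequality
  \<open>sqrt p \<le> 5 (A + B) + 9\<close> between the geometric and the arithmetic mean of
  \<open>10 A + 9\<close> and \<open>10 B + 9\<close>.
\<close>

lemma nine_dvd_mult_add_one:
  fixes A B :: nat
  assumes "9 dvd (10 * A + 9) * (10 * B + 9) + 10"
  shows "9 dvd A * B + 1"
proof -
  have "(10 * A + 9) * (10 * B + 9) + 10 = (A * B + 1) + 9 * (11 * (A * B) + 10 * A + 10 * B + 10)"
    by (simp add: algebra_simps)
  with assms show ?thesis
    by (metis dvd_add_left_iff dvd_triv_left)
qed

lemma roots_from_sum_and_product:
  fixes a b s q :: real
  assumes "a \<le> b" and "a + b = s" and "a * b = q"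
  shows "a = (s - sqrt (s^2 - 4 * q)) / 2" and "b = (s + sqrt (s^2 - 4 * q)) / 2"
proof -
  have "s^2 - 4 * q = (b - a)^2"
    using assms by (auto simp: power2_eq_square algebra_simps)
  then have "sqrt (s^2 - 4 * q) = b - a"
    using \<open>a \<le> b\<close> by simp
  then show "a = (s - sqrt (s^2 - 4 * q)) / 2" and "b = (s + sqrt (s^2 - 4 * q)) / 2"
    using assms(2) by auto
qed

lemma mult_add_one_le:
  fixes a b :: real
  assumes "a \<ge> 10" and "b \<ge> 10"
  shows "(a + 1) * (b + 1) \<le> 101^2 * ((10 * a + 9) * (10 * b + 9)) / 10^6"
proof -
  have "(a + 1) * (b + 1) \<le> (101 / 1000 * (10 * a + 9)) * (101 / 1000 * (10 * b + 9))"
    using assms by (intro mult_mono) auto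
  also have "\<dots> = 101^2 * ((10 * a + 9) * (10 * b + 9)) / 10^6"
    by (simp add: field_simps)
  finally show ?thesis .
qed

theorem theorem2p3:
  fixes p A B :: nat
  assumes "p > 0"
    and "p mod 10 = 1"
    and "p mod 3 = 2 \<or> p mod 3 = 1"
    and "9 dvd p + 10"
    and "A > 0" and "B > 0" and "A < B"
    and "p = (10 * A + 9) * (10 * B + 9)"
  shows "\<exists>(lam::nat) (C::nat) (D::nat).
    real A = (real D + 1 - 10 * real lam
        - sqrt ((10 * real lam - 1 - real D)^2 - 4 * (9 * real lam - 1))) / 2 \<and>
    real B = (real D + 1 - 10 * real lam
        + sqrt ((10 * real lam - 1 - real D)^2 - 4 * (9 * real lam - 1))) / 2 \<and>
    (A \<ge> 10 \<and> B \<ge> 10 \<longrightarrow>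
      real D + 1 - 101^2 * real p / 10^6 \<le> real lam \<and>
      real lam \<le> (real D + 1) / 10 + (9 - sqrt (real p)) / 50)"
proof -
  obtain lam where "A * B + 1 = 9 * lam"
    using nine_dvd_mult_add_one assms(4,8) by (metis dvdE)
  then have "real (A * B + 1) = real (9 * lam)"
    by (rule arg_cong)
  then have prod: "real A * real B = 9 * real lam - 1"
    by simp
  \<comment> \<open>The truncated subtraction is exact because \<open>A + B\<close> is positive.\<close>
  define D where "D = A + B - 1 + 10 * lam"
  have "real (A + B - 1) = real A + real B - 1"
    using \<open>A > 0\<close> by (simp add: of_nat_diff)
  then have sum: "real A + real B = real D + 1 - 10 * real lam"
    by (simp add: D_def)
  have p: "real p = (10 * real A + 9) * (10 * real B + 9)"
    using assms(8) by simp
  have disc: "(real D + 1 - 10 * real lam)^2 = (10 * real lam - 1 - real D)^2"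
    by (simp add: power2_eq_square algebra_simps)
  have "real A \<le> real B"
    using \<open>A < B\<close> by simp
  note roots = roots_from_sum_and_product[OF this sum prod, unfolded disc]
  have lower: "real D + 1 - 101^2 * real p / 10^6 \<le> real lam" if "A \<ge> 10" "B \<ge> 10"
  proof -
    have "real D + 1 - real lam = (real A + 1) * (real B + 1)"
      using sum prod by (simp add: algebra_simps)
    also have "\<dots> \<le> 101^2 * real p / 10^6"
      unfolding p using that by (intro mult_add_one_le) auto
    finally show ?thesis by linarith
  qed
  have "sqrt (real p) \<le> (10 * real A + 9 + (10 * real B + 9)) / 2"
    unfolding p by (intro arith_geo_mean_sqrt) auto
  then have upper: "real lam \<le> (real D + 1) / 10 + (9 - sqrt (real p)) / 50"
    using sum by (simp add: field_simps)
  show ?thesis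
    using roots lower upper by blast
qed

end
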